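(* Let $\alpha,\beta\in(0,1)$ be such that at least one of them is irrational. For each $\varepsilon>0$ there is a constant $C=C(\alpha,\beta,\varepsilon)>0$ such that the following holds. Let $h\in\mathbb{Z}\setminus\{0\}$. Then for $\mathbb{P}$-almost all $\mathbf{x}\in\Sigma$ and for every $\varepsilon>0$ there exists $N_0$ (which may depend on $\mathbf{x},h,\varepsilon,\alpha,\beta$) such that for all $N\ge N_0$ $$\left|\sum_{n=1}^N \mathbf{e}(hS_n(\mathbf{x}))\right|\le C(\alpha,\beta,\varepsilon)\,N^{1/2}(\log N)^{3/2+\varepsilon}.$$
   Context: $\mathbf{e}(x)=\exp(2\pi i x)$. $\Sigma=\{1,2\}^{\mathbb{N}}$ is the set of sequences $\mathbf{x}=(x_1,x_2,\ldots)$ with $x_n\in\{1,2\}$, and $\mathbb{P}$ is the product probability measure on $\Sigma$ under which the coordinates $x_i$ are independent and each takes the values $1$ and $2$ with probability $1/2$. For $\mathbf{x}\in\Sigma$ and $i,n\in\mathbb{N}=\{1,2,\ldots\}$ put $X_i(\mathbf{x})=\alpha$ if $x_i=1$, $X_i(\mathbf{x})=\beta$ if $x_i=2$, and $S_n(\mathbf{x})=\sum_{i=1}^n X_i(\mathbf{x})$. *)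

theory Defs
  imports "HOL-Probability.Probability"
begin

definition e :: "real \<Rightarrow> complex" where
  "e x = exp (2 * complex_of_real pi * \<i> * complex_of_real x)"

text \<open>The probability measure on \<open>\<Sigma> = {1,2}\<^sup>\<nat>\<close> with positions \<open>1, 2, \<dots>\<close>; its space is
  \<open>{1..} \<rightarrow>\<^sub>E {1,2}\<close>, so index 0 carries no information.\<close>

definition coin_measure :: "(nat \<Rightarrow> nat) measure" where
  "coin_measure = PiM {1..} (\<lambda>_. uniform_count_measure {1, 2})"

definition X :: "real \<Rightarrow> real \<Rightarrow> (nat \<Rightarrow> nat) \<Rightarrow> nat \<Rightarrow> real" where
  "X \<alpha> \<beta> x i = (if x i = 1 then \<alpha> else \<beta>)"

definition S :: "real \<Rightarrow> real \<Rightarrow> (nat \<Rightarrow> nat) \<Rightarrow> nat \<Rightarrow> real" where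
  "S \<alpha> \<beta> x n = (\<Sum>i=1..n. X \<alpha> \<beta> x i)"

end

theory Submission
  imports Defs "HOL-Real_Asymp.Real_Asymp"
begin

text \<open>Put \<open>Z\<^sub>n = e (h S\<^sub>n)\<close> and let \<open>\<phi>\<close>, \<open>d\<close> be half the sum and half the difference of \<open>e (h \<alpha>)\<close>
  and \<open>e (h \<beta>)\<close>. With the fair sign \<open>\<sigma>\<^sub>n\<^sub>+\<^sub>1\<close> of the next toss, \<open>Z\<^sub>n\<^sub>+\<^sub>1 = (\<phi> + \<sigma>\<^sub>n\<^sub>+\<^sub>1 d) Z\<^sub>n\<close>, so
  \<open>1 - \<phi>\<close> times the exponential sum is a bounded term plus \<open>d\<close> times the martingale
  \<open>V\<^sub>N = \<Sum> \<sigma>\<^sub>n\<^sub>+\<^sub>1 Z\<^sub>n\<close>. Irrationality gives \<open>\<phi> \<noteq> 1\<close>. Azuma's exponential moment bound at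
  \<open>t = 2 sqrt (ln N / N)\<close> and summability of \<open>N\<^sup>-\<^sup>2\<close> give \<open>V\<^sub>N = O(sqrt (N ln N))\<close> almost surely. The
  dependence on \<open>h\<close> through \<open>1 - \<phi>\<close> is absorbed by the spare power of the logarithm,
  so \<open>C = 1\<close> works.\<close>

section \<open>The sub-Gaussian bound for a fair sign\<close>

lemma cosh_le_exp_square: "cosh x \<le> exp (x\<^sup>2 / 2)" for x :: real
proof -
  have "cosh y \<le> exp (y\<^sup>2 / 2)" if "y \<ge> 0" for y :: real
  proof -
    \<comment> \<open>Hoeffding's auxiliary inequality at \<open>h = 2*y\<close> and
      \<open>p = 1/2\<close> bounds \<open>- y + ln (exp y * cosh y)\<close> by
      \<open>(2*y)\<^sup>2 / 8\<close>. It needs a nonnegative argument; negative ones follow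
      because \<open>cosh\<close> is even.\<close>
    have "1 + (1/2) * (exp (2*y) - 1) = exp y * cosh y"
      by (simp add: cosh_def exp_minus field_simps flip: exp_add)
    with Hoeffdings_lemma_aux[of "2*y" "1/2"] that
    have "ln (exp y * cosh y) \<le> y + y\<^sup>2 / 2"
      by (simp add: power2_eq_square)
    then have "ln (cosh y) \<le> y\<^sup>2 / 2"
      by (simp add: ln_mult)
    then show ?thesis
      by (metis cosh_real_pos exp_le_cancel_iff exp_ln)
  qed
  from this[of "\<bar>x\<bar>"] show ?thesis by simp
qed

section \<open>Isolating one toss in the product measure\<close>

lemma prob_space_coin_measure: "prob_space coin_measure"
  unfolding coin_measure_def by (intro prob_space_PiM prob_space_uniform_count_measure) auto

lemma measurable_coin_component:
  assumes "i \<ge> 1"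
  shows "(\<lambda>x. f (x i)) \<in> borel_measurable coin_measure"
proof -
  have "(\<lambda>x. x i) \<in> coin_measure \<rightarrow>\<^sub>M uniform_count_measure {1, 2}"
    unfolding coin_measure_def using assms by (intro measurable_component_singleton) auto
  moreover have "f \<in> borel_measurable (uniform_count_measure {1, 2})"
    by (subst measurable_cong_sets[OF sets_uniform_count_measure_count_space refl]) simp
  ultimately show ?thesis
    by (rule measurable_compose)
qed

text \<open>The product measure is the law of an independent fair toss inserted at position
  \<open>i\<close>, so Tonelli's theorem lets that toss be averaged first. This takes the place of
  conditional expectation: inequalities need only be checked for the mean over the two values of one
  coordinate.\<close>

lemma nn_integral_coin_measure_split:
  assumes [measurable]: "f \<in> borel_measurable coin_measure" and i: "i \<ge> 1"
  shows "(\<integral>\<^sup>+x. f x \<partial>coin_measure) =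
    (\<integral>\<^sup>+x. (f (x(i := 1)) + f (x(i := 2))) / 2
      \<partial>PiM ({1..} - {i}) (\<lambda>_. uniform_count_measure {1, 2 :: nat}))"
proof -
  let ?U = "uniform_count_measure {1, 2 :: nat}"
  let ?P = "PiM ({1..} - {i}) (\<lambda>_. ?U)"
  have U: "prob_space ?U"
    by (intro prob_space_uniform_count_measure) auto
  interpret U: prob_space ?U by (rule U)
  interpret P: prob_space ?P by (intro prob_space_PiM U)
  have ins: "insert i ({1..} - {i}) = {1..}" using i by auto
  have split: "coin_measure = distr (?U \<Otimes>\<^sub>M ?P) coin_measure (\<lambda>(v, x). x(i := v))"
    using distr_pair_PiM_eq_PiM[of "{1..} - {i}" "\<lambda>_. ?U" i] U
    unfolding coin_measure_def ins by simp
  have meas: "(\<lambda>(v, x). x(i := v)) \<in> ?U \<Otimes>\<^sub>M ?P \<rightarrow>\<^sub>M coin_measure"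
  proof -
    have "(\<lambda>(v, x). x(i := v)) \<in> ?U \<Otimes>\<^sub>M ?P \<rightarrow>\<^sub>M PiM (insert i ({1..} - {i})) (\<lambda>_. ?U)"
      by measurable
    then show ?thesis unfolding coin_measure_def ins .
  qed
  have [measurable]: "(\<lambda>x. f (x(i := v))) \<in> borel_measurable ?P" if "v \<in> {1, 2}" for v
  proof -
    have "(\<lambda>x. (v, x)) \<in> ?P \<rightarrow>\<^sub>M ?U \<Otimes>\<^sub>M ?P"
      using that by (intro measurable_Pair1') (simp add: space_uniform_count_measure)
    from measurable_comp[OF measurable_comp[OF this meas] assms(1)] show ?thesis
      by (simp add: comp_def)
  qed
  have "(\<integral>\<^sup>+x. f x \<partial>coin_measure) = (\<integral>\<^sup>+(v, x). f (x(i := v)) \<partial>(?U \<Otimes>\<^sub>M ?P))"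
    by (subst split, subst nn_integral_distr) (use meas in \<open>auto simp: case_prod_unfold\<close>)
  also have "\<dots> = (\<integral>\<^sup>+v. \<integral>\<^sup>+x. f (x(i := v)) \<partial>?P \<partial>?U)"
    using measurable_comp[OF meas assms(1)]
    by (subst P.nn_integral_fst[symmetric]) (auto simp: comp_def case_prod_unfold)
  also have "\<dots> = (\<Sum>v\<in>{1, 2}. (\<integral>\<^sup>+x. f (x(i := v)) \<partial>?P) / 2)"
    unfolding uniform_count_measure_def
    by (subst nn_integral_point_measure_finite) (auto simp: divide_ennreal_def mult.commute)
  also have "\<dots> = (\<integral>\<^sup>+x. (f (x(i := 1)) + f (x(i := 2))) / 2 \<partial>?P)"
    by (subst nn_integral_divide, measurable, subst nn_integral_add)
      (auto simp: add_divide_distrib_ennreal simp del: One_nat_def)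
  finally show ?thesis .
qed

section \<open>Exponential moments and growth of martingale transforms\<close>

definition coin_sign :: "(nat \<Rightarrow> nat) \<Rightarrow> nat \<Rightarrow> real" where
  "coin_sign x i = (if x i = 1 then 1 else -1)"

lemma measurable_coin_sign:
  "i \<ge> 1 \<Longrightarrow> (\<lambda>x. coin_sign x i) \<in> borel_measurable coin_measure"
  unfolding coin_sign_def by (rule measurable_coin_component)

text \<open>Azuma's bound. Predictability is expressed by \<open>a n\<close> being unaffected by
  changes to tosses after time \<open>n\<close>. With the past fixed, averaging over toss
  \<open>Suc n\<close> therefore multiplies the exponential by \<open>cosh (t * a n x)\<close>,
  which is at most \<open>exp (t\<^sup>2 / 2)\<close>.\<close>

lemma nn_integral_exp_predictable_sum_le:
  fixes a :: "nat \<Rightarrow> (nat \<Rightarrow> nat) \<Rightarrow> real"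
  assumes meas [measurable]: "\<And>n. a n \<in> borel_measurable coin_measure"
    and bound: "\<And>n x. \<bar>a n x\<bar> \<le> 1"
    and predictable: "\<And>n i x v. n < i \<Longrightarrow> a n (x(i := v)) = a n x"
  shows "(\<integral>\<^sup>+x. ennreal (exp (t * (\<Sum>m<n. coin_sign x (Suc m) * a m x))) \<partial>coin_measure)
    \<le> ennreal (exp (real n * t\<^sup>2 / 2))"
proof (induction n)
  case 0
  interpret prob_space coin_measure by (rule prob_space_coin_measure)
  show ?case by (simp add: emeasure_space_1)
next
  case (Suc n)
  note measurable_coin_sign [measurable]
  define W where "W n x = (\<Sum>m<n. coin_sign x (Suc m) * a m x)" for n x
  have W_meas [measurable]: "W n \<in> borel_measurable coin_measure" for n
    unfolding W_def by measurable
  define f where "f n x = ennreal (exp (t * W n x))" for n x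
  have [measurable]: "f n \<in> borel_measurable coin_measure" for n
    unfolding f_def by measurable
  define c where "c = ennreal (exp (t\<^sup>2 / 2))"
  let ?i = "Suc n"
  \<comment> \<open>The two terms on the right are equal, since \<open>f n\<close> ignores
    coordinate \<open>?i\<close>. They are kept apart so that both integrals can be split at the
    same coordinate and compared pointwise.\<close>
  have step: "f ?i (x(?i := 1)) + f ?i (x(?i := 2)) \<le> c * f n (x(?i := 1)) + c * f n (x(?i := 2))"
    for x
  proof -
    have Wn: "W n (x(?i := v)) = W n x" for v
      unfolding W_def by (intro sum.cong) (auto simp: predictable coin_sign_def)
    have W1: "W ?i (x(?i := 1)) = W n x + a n x" and W2: "W ?i (x(?i := 2)) = W n x - a n x"
      using Wn[of 1] Wn[of 2] by (auto simp: W_def predictable coin_sign_def)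
    have "exp (t * (W n x + a n x)) + exp (t * (W n x - a n x))
        = 2 * (exp (t * W n x) * cosh (t * a n x))"
      by (simp add: cosh_def algebra_simps flip: exp_add)
    also have "\<dots> \<le> 2 * (exp (t * W n x) * exp (t\<^sup>2 / 2))"
    proof (intro mult_left_mono)
      have "(a n x)\<^sup>2 \<le> 1"
        using bound by (simp add: abs_square_le_1)
      then have "(t * a n x)\<^sup>2 \<le> t\<^sup>2"
        by (simp add: power_mult_distrib mult_left_le)
      with cosh_le_exp_square[of "t * a n x"] show "cosh (t * a n x) \<le> exp (t\<^sup>2 / 2)"
        by (meson divide_right_mono exp_le_cancel_iff order_trans zero_le_numeral)
    qed auto
    finally show ?thesis
      by (simp add: f_def c_def W1 W2 Wn del: One_nat_def flip: ennreal_plus ennreal_mult')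
  qed
  have "(\<integral>\<^sup>+x. f ?i x \<partial>coin_measure) \<le> (\<integral>\<^sup>+x. c * f n x \<partial>coin_measure)"
    by (subst (1 2) nn_integral_coin_measure_split[where i = "?i"])
      (auto intro!: nn_integral_mono divide_right_mono_ennreal step simp del: One_nat_def)
  also have "\<dots> = c * (\<integral>\<^sup>+x. f n x \<partial>coin_measure)"
    by (intro nn_integral_cmult) measurable
  also have "\<dots> \<le> c * ennreal (exp (real n * t\<^sup>2 / 2))"
    using Suc unfolding f_def W_def by (intro mult_left_mono) auto
  also have "\<dots> = ennreal (exp (real ?i * t\<^sup>2 / 2))"
    by (simp add: c_def add_divide_distrib algebra_simps flip: ennreal_mult' exp_add)
  finally show ?case unfolding f_def W_def .
qed

text \<open>A Borel-Cantelli argument carried out with integrals: nonnegative functions whose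
  integrals have a finite sum are almost surely summable, hence tend to 0 and are eventually below
  1.\<close>

lemma AE_predictable_sum_le:
  fixes a :: "nat \<Rightarrow> (nat \<Rightarrow> nat) \<Rightarrow> real"
  assumes meas [measurable]: "\<And>n. a n \<in> borel_measurable coin_measure"
    and bound: "\<And>n x. \<bar>a n x\<bar> \<le> 1"
    and predictable: "\<And>n i x v. n < i \<Longrightarrow> a n (x(i := v)) = a n x"
  shows "AE x in coin_measure. \<forall>\<^sub>F n in sequentially.
    (\<Sum>m<n. coin_sign x (Suc m) * a m x) \<le> 2 * sqrt (real n * ln (real n))"
proof -
  note measurable_coin_sign [measurable]
  define W where "W n x = (\<Sum>m<n. coin_sign x (Suc m) * a m x)" for n x
  have W_meas [measurable]: "W n \<in> borel_measurable coin_measure" for n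
    unfolding W_def by measurable
  define t where "t n = 2 * sqrt (ln (real n) / real n)" for n
  \<comment> \<open>At the threshold \<open>W n x = 2 * sqrt (n * ln n)\<close> the product
    \<open>t n * W n x\<close> is \<open>4 * ln n\<close>, so \<open>f n x < 1\<close> puts
    \<open>W n x\<close> below it for \<open>n \<ge> 2\<close>. The moment bound contributes
    \<open>2 * ln n\<close> to the exponent, which leaves an integral of at most
    \<open>n\<^sup>-\<^sup>2\<close>.\<close>
  define f where "f n x = exp (t n * W n x - 4 * ln (real n))" for n x
  \<comment> \<open>The shift to \<open>Suc n\<close> avoids index 0, where the right-hand side
    would be \<open>inverse 0 = 0\<close> although \<open>f 0 x\<close> is positive.\<close>
  have f_le: "(\<integral>\<^sup>+x. ennreal (f (Suc n) x) \<partial>coin_measure) \<le> ennreal (inverse (real (Suc n) ^ 2))" for n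
  proof -
    define N where "N = Suc n"
    have N: "real N \<ge> 1" by (simp add: N_def)
    have t2: "real N * (t N)\<^sup>2 / 2 = 2 * ln (real N)"
      using N by (simp add: t_def power_mult_distrib)
    have "(\<integral>\<^sup>+x. ennreal (f N x) \<partial>coin_measure)
        = (\<integral>\<^sup>+x. ennreal (exp (- 4 * ln (real N))) * ennreal (exp (t N * W N x)) \<partial>coin_measure)"
      by (intro nn_integral_cong) (simp add: f_def flip: ennreal_mult' exp_add)
    also have "\<dots> = ennreal (exp (- 4 * ln (real N))) * (\<integral>\<^sup>+x. ennreal (exp (t N * W N x)) \<partial>coin_measure)"
      by (intro nn_integral_cmult) measurable
    also have "\<dots> \<le> ennreal (exp (- 4 * ln (real N))) * ennreal (exp (real N * (t N)\<^sup>2 / 2))"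
      unfolding W_def
      by (intro mult_left_mono nn_integral_exp_predictable_sum_le meas bound predictable) auto
    also have "\<dots> = ennreal (exp (- (2 * ln (real N))))"
      unfolding t2 by (simp flip: ennreal_mult' exp_add)
    also have "exp (- (2 * ln (real N))) = inverse (real N ^ 2)"
      using N by (simp add: exp_minus exp_double)
    finally show ?thesis by (simp add: N_def)
  qed
  have "(\<integral>\<^sup>+x. (\<Sum>n. ennreal (f (Suc n) x)) \<partial>coin_measure)
      = (\<Sum>n. \<integral>\<^sup>+x. ennreal (f (Suc n) x) \<partial>coin_measure)"
    unfolding f_def by (intro nn_integral_suminf) measurable
  also have "\<dots> \<le> (\<Sum>n. ennreal (inverse (real (Suc n) ^ 2)))"
    by (intro suminf_le f_le) auto
  also have "\<dots> < \<infinity>"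
  proof -
    have "summable (\<lambda>n. inverse (real (Suc n) ^ 2))"
      using inverse_power_summable[of 2, where 'a = real]
      by (simp only: summable_Suc_iff[of "\<lambda>n. inverse (real n ^ 2)"])
    then show ?thesis
      unfolding infinity_ennreal_def less_top[symmetric] by (rule ennreal_suminf_neq_top) simp
  qed
  finally have "AE x in coin_measure. (\<Sum>n. ennreal (f (Suc n) x)) \<noteq> \<infinity>"
    by (intro nn_integral_noteq_infinite) (auto simp: f_def)
  then show ?thesis
  proof eventually_elim
    case (elim x)
    have "summable (\<lambda>n. f (Suc n) x)"
      using elim by (intro summable_suminf_not_top) (auto simp: f_def)
    then have "(\<lambda>n. f n x) \<longlonglongrightarrow> 0"
      by (simp only: summable_Suc_iff[of "\<lambda>n. f n x"] summable_LIMSEQ_zero)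
    then have "\<forall>\<^sub>F n in sequentially. f n x < 1"
      by (rule order_tendstoD) auto
    then show ?case
      \<comment> \<open>From 2 on the logarithm is positive, so the factor
        \<open>2 * sqrt (l / real n)\<close> can be cancelled.\<close>
      using eventually_ge_at_top[of 2]
    proof eventually_elim
      case (elim n)
      define l where "l = ln (real n)"
      have l: "l > 0" using elim by (simp add: l_def)
      have n: "real n > 0" using elim by simp
      have "2 * sqrt (l / real n) * W n x < 4 * l"
        using elim by (simp add: f_def t_def l_def)
      also have "4 * l = 2 * sqrt (l / real n) * (2 * sqrt (real n * l))"
        using l n by (simp flip: real_sqrt_mult)
      finally have "W n x < 2 * sqrt (real n * l)"
        using l n by (simp add: mult_less_cancel_left_pos)
      then show ?case by (simp add: W_def l_def)
    qed
  qed
qed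

section \<open>The character \<open>e\<close> and when an average of two values is 1\<close>

lemma e_add: "e (x + y) = e x * e y"
  by (simp add: e_def distrib_left exp_add)

lemma norm_e [simp]: "norm (e x) = 1"
  by (simp add: e_def)

lemma e_0 [simp]: "e 0 = 1"
  by (simp add: e_def)

lemma Re_e: "Re (e x) = cos (2 * pi * x)"
  by (simp add: e_def Re_exp)

text \<open>Both cosines are at most 1 and sum to 2, so each equals 1. The contrapositive is what
  excludes \<open>\<phi> = 1\<close> for an irrational parameter.\<close>

lemma e_average_neq_1:
  assumes "(e x + e y) / 2 = 1"
  shows "x \<in> \<int> \<and> y \<in> \<int>"
proof -
  have int: "x \<in> \<int>" if "cos (2 * pi * x) = 1" for x
  proof -
    from that obtain k :: int where "2 * pi * x = of_int k * 2 * pi"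
      by (auto simp: cos_one_2pi_int)
    then have "x = of_int k" by simp
    then show ?thesis by simp
  qed
  have "e x + e y = 2" using assms by simp
  then have "Re (e x + e y) = 2" by simp
  then have "cos (2 * pi * x) + cos (2 * pi * y) = 2" by (simp add: Re_e)
  then have "cos (2 * pi * x) = 1 \<and> cos (2 * pi * y) = 1"
    using cos_le_one[of "2 * pi * x"] cos_le_one[of "2 * pi * y"] by linarith
  with int show ?thesis by blast
qed

section \<open>From the martingale to the exponential sum\<close>

theorem theorem1p2:
  fixes \<alpha> \<beta> :: real
  assumes "\<alpha> \<in> {0<..<1}" and "\<beta> \<in> {0<..<1}"
    and "\<alpha> \<notin> \<rat> \<or> \<beta> \<notin> \<rat>"
  shows "\<exists>C :: real \<Rightarrow> real. (\<forall>\<epsilon>>0. C \<epsilon> > 0) \<and>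
    (\<forall>h :: int. h \<noteq> 0 \<longrightarrow>
      (AE x in coin_measure. \<forall>\<epsilon>>0. \<exists>N\<^sub>0 :: nat. \<forall>N\<ge>N\<^sub>0.
        cmod (\<Sum>n=1..N. e (of_int h * S \<alpha> \<beta> x n))
          \<le> C \<epsilon> * real N powr (1/2) * ln (real N) powr (3/2 + \<epsilon>)))"
proof (intro exI[of _ "\<lambda>_. 1"] conjI allI impI)
  fix h :: int assume h: "h \<noteq> 0"
  define \<phi> where "\<phi> = (e (of_int h * \<alpha>) + e (of_int h * \<beta>)) / 2"
  define d where "d = (e (of_int h * \<alpha>) - e (of_int h * \<beta>)) / 2"
  define Z where "Z n x = e (of_int h * S \<alpha> \<beta> x n)" for n x
  define V where "V n x = (\<Sum>m<n. of_real (coin_sign x (Suc m)) * Z m x)" for n x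
  have \<phi>: "\<phi> \<noteq> 1"
  proof
    have rat: "\<gamma> \<in> \<rat>" if "of_int h * \<gamma> \<in> \<int>" for \<gamma> :: real
    proof -
      have "\<gamma> = (of_int h * \<gamma>) / of_int h" using h by simp
      also have "\<dots> \<in> \<rat>" using that Ints_subset_Rats by (intro Rats_divide) auto
      finally show ?thesis .
    qed
    assume "\<phi> = 1"
    then show False
      using e_average_neq_1[of "of_int h * \<alpha>" "of_int h * \<beta>"] rat assms(3) by (auto simp: \<phi>_def)
  qed
  have d: "norm d \<le> 1"
    using norm_triangle_ineq4[of "e (of_int h * \<alpha>)" "e (of_int h * \<beta>)"]
    by (simp add: d_def norm_divide)
  have Z0: "Z 0 x = 1" for x
    by (simp add: Z_def S_def)
  have normZ [simp]: "norm (Z n x) = 1" for n x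
    by (simp add: Z_def)
  have Z_Suc: "Z (Suc n) x = \<phi> * Z n x + d * (of_real (coin_sign x (Suc n)) * Z n x)" for n x
    by (simp add: Z_def S_def X_def coin_sign_def \<phi>_def d_def e_add distrib_left field_simps)
  \<comment> \<open>This is \<open>Z_Suc\<close> summed over times \<open>0\<close> to
    \<open>N - 1\<close>; moving the index range to \<open>1..N\<close> leaves the boundary term
    \<open>1 - Z N x\<close>.\<close>
  have sum_eq: "(1 - \<phi>) * (\<Sum>n=1..N. Z n x) = \<phi> * (1 - Z N x) + d * V N x" for N x
    by (induction N) (simp_all add: Z0 V_def algebra_simps Z_Suc)
  have S_meas: "(\<lambda>x. S \<alpha> \<beta> x n) \<in> borel_measurable coin_measure" for n
  proof -
    have "(\<lambda>x. X \<alpha> \<beta> x i) \<in> borel_measurable coin_measure" if "i \<in> {1..n}" for i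
      using that unfolding X_def by (intro measurable_coin_component) auto
    then show ?thesis unfolding S_def by (rule borel_measurable_sum)
  qed
  have Z_meas [measurable]: "Z n \<in> borel_measurable coin_measure" for n
  proof -
    note S_meas [measurable]
    show ?thesis unfolding Z_def e_def by measurable
  qed
  have S_upd: "S \<alpha> \<beta> (x(i := v)) n = S \<alpha> \<beta> x n" if "n < i" for n i x v
    using that unfolding S_def X_def by (intro sum.cong) auto
  \<comment> \<open>The growth lemma bounds real sums from one side, so the complex \<open>V\<close>
    is tested in the directions \<open>1\<close>, \<open>-1\<close>, \<open>\<i>\<close> and
    \<open>-\<i>\<close>. Together these control the absolute values of its real and imaginary
    parts.\<close>
  have W: "AE x in coin_measure. \<forall>\<^sub>F n in sequentially. Re (c * V n x) \<le> 2 * sqrt (real n * ln (real n))"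
    if c: "norm c = 1" for c
  proof -
    have "AE x in coin_measure. \<forall>\<^sub>F n in sequentially.
      (\<Sum>m<n. coin_sign x (Suc m) * Re (c * Z m x)) \<le> 2 * sqrt (real n * ln (real n))"
    proof (rule AE_predictable_sum_le)
      show "(\<lambda>x. Re (c * Z n x)) \<in> borel_measurable coin_measure" for n
        by measurable
    next
      fix n x
      show "\<bar>Re (c * Z n x)\<bar> \<le> 1"
        using abs_Re_le_cmod[of "c * Z n x"] c by (simp add: norm_mult)
    qed (simp add: Z_def S_upd)
    moreover have "(\<Sum>m<n. coin_sign x (Suc m) * Re (c * Z m x)) = Re (c * V n x)" for n x
      by (simp add: V_def sum_distrib_left algebra_simps sum_subtractf)
    ultimately show ?thesis by simp
  qed
  \<comment> \<open>The right side has a spare factor \<open>ln N powr (1 + \<epsilon>)\<close>,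
    which outgrows every constant and hence \<open>1 / K\<close>.\<close>
  have asymp: "\<forall>\<^sub>F N in sequentially. (2 + 4 * sqrt (real N * ln (real N)))
      \<le> K * (real N powr (1/2) * ln (real N) powr (3/2 + \<epsilon>))" if "\<epsilon> > 0" "K > 0" for \<epsilon> K :: real
    using that by real_asymp
  show "AE x in coin_measure. \<forall>\<epsilon>>0. \<exists>N\<^sub>0 :: nat. \<forall>N\<ge>N\<^sub>0.
        cmod (\<Sum>n=1..N. e (of_int h * S \<alpha> \<beta> x n))
          \<le> 1 * real N powr (1/2) * ln (real N) powr (3/2 + \<epsilon>)"
    \<comment> \<open>None of these four almost sure events involves \<open>\<epsilon>\<close>, so
      one null set serves all \<open>\<epsilon>\<close> at once.\<close>
    using W[of 1, simplified] W[of "-1", simplified] W[of \<i>, simplified] W[of "-\<i>", simplified]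
  proof eventually_elim
    case (elim x)
    show ?case unfolding eventually_sequentially[symmetric]
    proof (intro allI impI)
      fix \<epsilon> :: real assume "\<epsilon> > 0"
      define K where "K = norm (1 - \<phi>)"
      have K: "K > 0" using \<phi> by (simp add: K_def)
      show "\<forall>\<^sub>F N in sequentially. cmod (\<Sum>n=1..N. e (of_int h * S \<alpha> \<beta> x n))
          \<le> 1 * real N powr (1/2) * ln (real N) powr (3/2 + \<epsilon>)"
        using asymp[OF \<open>\<epsilon> > 0\<close> K] elim
      proof eventually_elim
        case (elim N)
        have \<phi>1: "norm \<phi> \<le> 1"
          using norm_triangle_ineq[of "e (of_int h * \<alpha>)" "e (of_int h * \<beta>)"]
          by (simp add: \<phi>_def norm_divide)
        have "norm (1 - Z N x) \<le> 2"
          using norm_triangle_ineq4[of 1 "Z N x"] by simp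
        have V: "norm (V N x) \<le> 4 * sqrt (real N * ln (real N))"
          using cmod_le[of "V N x"] elim by linarith
        have "K * norm (\<Sum>n=1..N. Z n x) = norm (\<phi> * (1 - Z N x) + d * V N x)"
          unfolding K_def sum_eq[symmetric] by (simp add: norm_mult)
        also have "\<dots> \<le> norm \<phi> * norm (1 - Z N x) + norm d * norm (V N x)"
          by (metis norm_mult norm_triangle_ineq)
        also have "\<dots> \<le> 1 * 2 + 1 * (4 * sqrt (real N * ln (real N)))"
          by (intro add_mono mult_mono \<phi>1 d V \<open>norm (1 - Z N x) \<le> 2\<close>) auto
        also have "\<dots> \<le> K * (real N powr (1/2) * ln (real N) powr (3/2 + \<epsilon>))"
          using elim by simp
        finally show ?case
          using K by (simp add: Z_def mult_le_cancel_left_pos)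
      qed
    qed
  qed
qed auto

end
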